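(* For $\mu\in\mathbb R_+^*$, the operation $\mathrm{Fr}^a_\mu$ on $W$-valued functions on a leaf, $$f\mapsto\mathrm{Fr}^a_\mu(f),\qquad \mathrm{Fr}^a_\mu(f):=\theta_\mu\big(R(\mu^{-1})(f)\big),$$ preserves the holomorphy condition $$(\lambda X+iY)\,\chi_\lambda(f)=0\qquad\forall\lambda\in\mathbb R_+^*.$$
   Context: $W$ is the complex group ring of the multiplicative group $\mathbb R_+^*$, with basis elements $[x]$, $x\in\mathbb R_+^*$, and $[xy]=[x][y]$. For $\lambda\in\mathbb R_+^*$, $\theta_\lambda$ is the automorphism of $W$ with $\theta_\lambda([x])=[x^\lambda]$, and $\chi_\lambda:W\to\mathbb C$ is the $\mathbb C$-linear ring homomorphism with $\chi_\lambda([x])=x^\lambda$; one has $\chi_\lambda\circ\theta_\mu=\chi_{\lambda\mu}$. Let $P_+(\mathbb R)=\left\{\begin{pmatrix} u&v\\0&1\end{pmatrix}:u>0,v\in\mathbb R\right\}$, and consider a leaf, i.e. an orbit of a right action of $P_+(\mathbb R)$; $X$ and $Y$ are the vector fields on it corresponding to the Lie algebra elements $\begin{pmatrix}0&1\\0&0\end{pmatrix}$ and $\begin{pmatrix}1&0\\0&0\end{pmatrix}$, so $[Y,X]=X$ (in coordinates $\begin{pmatrix} y&x\\0&1\end{pmatrix}$: $X=y\partial_x$, $Y=y\partial_y$). $R(\mu)$ denotes the right action of $\begin{pmatrix}\mu&0\\0&1\end{pmatrix}$ on $W$-valued functions, which satisfies $\chi_\lambda(R(\mu)(f))=\mu^Y\chi_\lambda(f)$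 for all $\lambda,\mu\in\mathbb R_+^*$ (in coordinates $(\mu^Yh)(x,y)=h(x,\mu y)$). Functions $f$ are $W$-valued with $\chi_\lambda(f)$ smooth for all $\lambda$. *)

theory Defs
  imports "HOL-Analysis.Analysis" "HOL-Library.Poly_Mapping"
begin

section \<open>The complex group ring of the multiplicative group of positive reals\<close>

text \<open>
  \<open>Poly_Mapping\<close> provides the (convolution) monoid ring over an \<^emph>\<open>additively\<close> written monoid.
  The group of positive reals under \<^emph>\<open>multiplication\<close> is therefore given as a type whose
  operation \<open>+\<close> is multiplication of reals, whose \<open>0\<close> is the real number 1 and whose \<open>uminus\<close>
  is the multiplicative inverse.
\<close>

typedef posreal = "{x::real. 0 < x}"
  by (rule exI[of _ 1]) simp

setup_lifting type_definition_posreal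

instantiation posreal :: ab_group_add
begin

lift_definition zero_posreal :: posreal is "1::real" by simp
lift_definition plus_posreal :: "posreal \<Rightarrow> posreal \<Rightarrow> posreal" is "(*)" by simp
lift_definition uminus_posreal :: "posreal \<Rightarrow> posreal" is inverse by simp
lift_definition minus_posreal :: "posreal \<Rightarrow> posreal \<Rightarrow> posreal" is "(/)" by simp

instance
  by (standard; transfer) (simp_all add: field_simps)

end

lift_definition posreal_powr :: "posreal \<Rightarrow> real \<Rightarrow> posreal" is "(powr)" by simp

type_synonym W = "posreal \<Rightarrow>\<^sub>0 complex"

definition grp :: "posreal \<Rightarrow> W" where
  "grp x = Poly_Mapping.single x 1"

definition theta_W :: "real \<Rightarrow> W \<Rightarrow> W" where
  "theta_W l w = (\<Sum>x\<in>Poly_Mapping.keys w.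
      Poly_Mapping.single (posreal_powr x l) (Poly_Mapping.lookup w x))"

definition chi_W :: "real \<Rightarrow> W \<Rightarrow> complex" where
  "chi_W l w = (\<Sum>x\<in>Poly_Mapping.keys w.
      Poly_Mapping.lookup w x * of_real (Rep_posreal x powr l))"

lemma grp_mult: "grp (x + y) = grp x * grp y"
  by (simp add: grp_def mult_single)

lemma theta_W_grp: "theta_W l (grp x) = grp (posreal_powr x l)"
  by (simp add: theta_W_def grp_def)

lemma chi_W_grp: "chi_W l (grp x) = of_real (Rep_posreal x powr l)"
  by (simp add: chi_W_def grp_def)

lemma theta_W_single: "theta_W l (Poly_Mapping.single x c) = Poly_Mapping.single (posreal_powr x l) c"
  by (simp add: theta_W_def)

lemma chi_W_single: "chi_W l (Poly_Mapping.single x c) = c * of_real (Rep_posreal x powr l)"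
  by (simp add: chi_W_def)

lemma posreal_powr_add: "posreal_powr (x + y) l = posreal_powr x l + posreal_powr y l"
  by transfer (simp add: powr_mult)

lemma posreal_powr_powr: "posreal_powr (posreal_powr x l) m = posreal_powr x (l * m)"
  by transfer (simp add: powr_powr)

lemma posreal_powr_one [simp]: "posreal_powr x 1 = x"
  by transfer simp

lemma theta_W_add: "theta_W l (v + w) = theta_W l v + theta_W l w"
  unfolding theta_W_def by (rule setsum_keys_plus_distrib) (simp_all add: single_add)

lemma chi_W_add: "chi_W l (v + w) = chi_W l v + chi_W l w"
  unfolding chi_W_def by (rule setsum_keys_plus_distrib) (simp_all add: algebra_simps)

lemma W_induct [case_names single add]:
  assumes s: "\<And>x c. P (Poly_Mapping.single x c)"
    and a: "\<And>v w. P v \<Longrightarrow> P w \<Longrightarrow> P (v + w)"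
  shows "P (w :: W)"
proof (induction w rule: update_induct)
  case const
  have "(0 :: W) = Poly_Mapping.single 0 0" by simp
  then show ?case using s by metis
next
  case (update f a b)
  have "Poly_Mapping.update a b f = f + Poly_Mapping.single a b"
    using update.hyps
    by (intro poly_mapping_eqI) (auto simp: lookup_update lookup_add lookup_single when_def in_keys_iff)
  then show ?case using update.IH s a by metis
qed

lemma theta_W_one: "theta_W l 1 = 1"
proof -
  have "posreal_powr 0 l = 0" by transfer simp
  then show ?thesis by (metis theta_W_single single_one)
qed

lemma chi_W_one: "chi_W l 1 = 1"
proof -
  have "Rep_posreal 0 = 1" by transfer simp
  then show ?thesis by (metis chi_W_single single_one powr_one_eq_one of_real_1 mult_1)
qed

lemma theta_W_mult: "theta_W l (v * w) = theta_W l v * theta_W l w"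
proof (induction v rule: W_induct)
  case (single x c)
  show ?case
    by (induction w rule: W_induct)
      (simp_all add: theta_W_add theta_W_single mult_single posreal_powr_add distrib_left)
qed (simp add: theta_W_add distrib_right)

lemma chi_W_mult: "chi_W l (v * w) = chi_W l v * chi_W l w"
proof (induction v rule: W_induct)
  case (single x c)
  have *: "Rep_posreal (a + b) powr l = Rep_posreal a powr l * Rep_posreal b powr l" for a b
    by transfer (simp add: powr_mult)
  show ?case
    by (induction w rule: W_induct)
      (simp_all add: chi_W_add chi_W_single mult_single * distrib_left)
qed (simp add: chi_W_add distrib_right)

lemma theta_W_theta_W: "theta_W m (theta_W l w) = theta_W (l * m) w"
  by (induction w rule: W_induct) (simp_all add: theta_W_add theta_W_single posreal_powr_powr)

lemma theta_W_1 [simp]: "theta_W 1 w = w"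
  by (induction w rule: W_induct) (simp_all add: theta_W_add theta_W_single)

lemma bij_theta_W: "0 < l \<Longrightarrow> bij (theta_W l)"
  by (rule o_bij[where g = "theta_W (1 / l)"]) (auto simp: theta_W_theta_W)

lemma chi_W_theta_W: "chi_W l (theta_W m w) = chi_W (l * m) w"
proof (induction w rule: W_induct)
  case (single x c)
  have "Rep_posreal (posreal_powr x m) powr l = Rep_posreal x powr (l * m)"
    by transfer (simp add: powr_powr mult.commute)
  then show ?case by (simp add: theta_W_single chi_W_single)
qed (simp add: theta_W_add chi_W_add)


section \<open>The affine group, right actions and leaves\<close>

definition affine_mat :: "real \<Rightarrow> real \<Rightarrow> real^2^2" where
  "affine_mat u v = vector [vector [u, v], vector [0, 1]]"

definition P_plus :: "(real^2^2) set" where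
  "P_plus = {affine_mat u v | u v. 0 < u}"

definition right_action :: "'a set \<Rightarrow> ('a \<Rightarrow> real^2^2 \<Rightarrow> 'a) \<Rightarrow> bool" where
  "right_action Z act \<longleftrightarrow>
     (\<forall>z\<in>Z. \<forall>g\<in>P_plus. act z g \<in> Z) \<and>
     (\<forall>z\<in>Z. act z (mat 1) = z) \<and>
     (\<forall>z\<in>Z. \<forall>g\<in>P_plus. \<forall>h\<in>P_plus. act (act z g) h = act z (g ** h))"

definition leaf :: "('a \<Rightarrow> real^2^2 \<Rightarrow> 'a) \<Rightarrow> 'a \<Rightarrow> 'a set" where
  "leaf act z = act z ` P_plus"

lemma affine_mat_mult: "affine_mat u v ** affine_mat u' v' = affine_mat (u * u') (u * v' + v)"
  by (simp add: affine_mat_def matrix_matrix_mult_def vec_eq_iff forall_2 sum_2)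

lemma mat_1_affine: "mat 1 = affine_mat 1 0"
  by (simp add: affine_mat_def mat_def vec_eq_iff forall_2)


section \<open>Smooth functions and vector fields on a leaf\<close>

text \<open>\<open>Ck_on k S h\<close>: \<open>h\<close> is of class \<open>C\<close>-\<open>k\<close> on \<open>S\<close>, meant for open \<open>S\<close>.\<close>

primrec Ck_on :: "nat \<Rightarrow> 'a::real_normed_vector set \<Rightarrow> ('a \<Rightarrow> 'b::real_normed_vector) \<Rightarrow> bool" where
  "Ck_on 0 S h \<longleftrightarrow> continuous_on S h"
| "Ck_on (Suc k) S h \<longleftrightarrow>
     (\<forall>x\<in>S. h differentiable (at x)) \<and> (\<forall>v. Ck_on k S (\<lambda>x. frechet_derivative h (at x) v))"

definition Cinf_on :: "'a::real_normed_vector set \<Rightarrow> ('a \<Rightarrow> 'b::real_normed_vector) \<Rightarrow> bool" where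
  "Cinf_on S h \<longleftrightarrow> (\<forall>k. Ck_on k S h)"

text \<open>
  An orbit carries the smooth structure of a quotient of the group \<open>P_plus\<close>: a function is
  smooth on it iff its pullbacks along the orbit maps are smooth in the coordinates \<open>(x, y)\<close>,
  \<open>y > 0\<close>, of the matrix with rows \<open>(y, x)\<close> and \<open>(0, 1)\<close>. Pullbacks at different base points
  differ by a left translation of the group.
\<close>

definition smooth_on_leaf :: "('a \<Rightarrow> real^2^2 \<Rightarrow> 'a) \<Rightarrow> 'a set \<Rightarrow> ('a \<Rightarrow> complex) \<Rightarrow> bool" where
  "smooth_on_leaf act L h \<longleftrightarrow>
     (\<forall>p\<in>L. Cinf_on {(x, y). 0 < y} (\<lambda>(x::real, y::real). h (act p (affine_mat y x))))"

definition matrix_exp :: "real^'n^'n \<Rightarrow> real^'n^'n" where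
  "matrix_exp A = suminf (\<lambda>k. (1 / fact k) *\<^sub>R (((**) A ^^ k) (mat 1)))"

definition lie_field ::
    "('a \<Rightarrow> real^2^2 \<Rightarrow> 'a) \<Rightarrow> real^2^2 \<Rightarrow> ('a \<Rightarrow> complex) \<Rightarrow> 'a \<Rightarrow> complex" where
  "lie_field act A h p = vector_derivative (\<lambda>t::real. h (act p (matrix_exp (t *\<^sub>R A)))) (at 0)"

definition X_field :: "('a \<Rightarrow> real^2^2 \<Rightarrow> 'a) \<Rightarrow> ('a \<Rightarrow> complex) \<Rightarrow> 'a \<Rightarrow> complex" where
  "X_field act = lie_field act (vector [vector [0, 1], vector [0, 0]])"

definition Y_field :: "('a \<Rightarrow> real^2^2 \<Rightarrow> 'a) \<Rightarrow> ('a \<Rightarrow> complex) \<Rightarrow> 'a \<Rightarrow> complex" where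
  "Y_field act = lie_field act (vector [vector [1, 0], vector [0, 0]])"

lemma matrix_exp_X:
  "matrix_exp (t *\<^sub>R vector [vector [0, 1], vector [0, 0]]) = affine_mat 1 t"
proof -
  let ?A = "t *\<^sub>R vector [vector [0, 1], vector [0, 0]] :: real^2^2"
  have sq: "?A ** (?A ** B) = 0" for B :: "real^2^2"
    by (simp add: matrix_matrix_mult_def vec_eq_iff forall_2 sum_2)
  have z: "((**) ?A ^^ k) (mat 1) = 0" if "k \<notin> {..<2}" for k
  proof -
    have "k = Suc (Suc (k - 2))"
      using that by simp
    then obtain j where "k = Suc (Suc j)" ..
    then show ?thesis by (simp add: sq)
  qed
  have "matrix_exp ?A = (\<Sum>k<2. (1 / fact k) *\<^sub>R (((**) ?A ^^ k) (mat 1)))"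
    unfolding matrix_exp_def by (rule suminf_finite) (use z in auto)
  also have "\<dots> = mat 1 + ?A"
    by (simp add: numeral_2_eq_2)
  also have "\<dots> = affine_mat 1 t"
    by (simp add: affine_mat_def mat_def vec_eq_iff forall_2)
  finally show ?thesis .
qed

lemma matrix_exp_Y:
  "matrix_exp (t *\<^sub>R vector [vector [1, 0], vector [0, 0]]) = affine_mat (exp t) 0"
proof -
  let ?E = "vector [vector [1, 0], vector [0, 0]] :: real^2^2"
  let ?F = "vector [vector [0, 0], vector [0, 1]] :: real^2^2"
  have pow: "((**) (t *\<^sub>R ?E) ^^ k) (mat 1) = (t ^ k) *\<^sub>R ?E + (if k = 0 then ?F else 0)" for k
    by (induction k)
      (auto simp: matrix_matrix_mult_def mat_def vec_eq_iff forall_2 sum_2)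
  have "(\<lambda>k. t ^ k /\<^sub>R fact k) sums exp t"
    by (rule exp_converges)
  then have 1: "(\<lambda>k. (t ^ k /\<^sub>R fact k) *\<^sub>R ?E) sums (exp t *\<^sub>R ?E)"
    by (rule sums_scaleR_left)
  have 2: "(\<lambda>k. if k = 0 then ?F else 0) sums ?F"
    using sums_single[of 0 "\<lambda>_. ?F"] by simp
  have "(\<lambda>k. (1 / fact k) *\<^sub>R (((**) (t *\<^sub>R ?E) ^^ k) (mat 1))) sums (exp t *\<^sub>R ?E + ?F)"
    by (rule sums_cong[THEN iffD1, OF _ sums_add[OF 1 2]])
      (unfold pow, simp add: scaleR_right_distrib field_simps)
  then have "matrix_exp (t *\<^sub>R ?E) = exp t *\<^sub>R ?E + ?F"
    unfolding matrix_exp_def by (simp add: sums_iff)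
  also have "\<dots> = affine_mat (exp t) 0"
    by (simp add: affine_mat_def vec_eq_iff forall_2)
  finally show ?thesis .
qed


section \<open>The operation and the holomorphy condition\<close>

definition R_act :: "('a \<Rightarrow> real^2^2 \<Rightarrow> 'a) \<Rightarrow> real \<Rightarrow> ('a \<Rightarrow> W) \<Rightarrow> 'a \<Rightarrow> W" where
  "R_act act m f p = f (act p (affine_mat m 0))"

definition Fr_a :: "('a \<Rightarrow> real^2^2 \<Rightarrow> 'a) \<Rightarrow> real \<Rightarrow> ('a \<Rightarrow> W) \<Rightarrow> 'a \<Rightarrow> W" where
  "Fr_a act m f p = theta_W m (R_act act (inverse m) f p)"

definition smooth_W :: "('a \<Rightarrow> real^2^2 \<Rightarrow> 'a) \<Rightarrow> 'a set \<Rightarrow> ('a \<Rightarrow> W) \<Rightarrow> bool" where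
  "smooth_W act L f \<longleftrightarrow> (\<forall>l>0. smooth_on_leaf act L (\<lambda>p. chi_W l (f p)))"

definition holomorphy_condition :: "('a \<Rightarrow> real^2^2 \<Rightarrow> 'a) \<Rightarrow> 'a set \<Rightarrow> ('a \<Rightarrow> W) \<Rightarrow> bool" where
  "holomorphy_condition act L f \<longleftrightarrow>
     (\<forall>l>0. \<forall>p\<in>L. of_real l * X_field act (\<lambda>q. chi_W l (f q)) p
                   + \<i> * Y_field act (\<lambda>q. chi_W l (f q)) p = 0)"

end

theory Submission
  imports Defs
begin

text \<open>
  Put \<open>a = affine_mat (inverse \<mu>) 0\<close>. Since \<open>\<chi>\<^sub>l \<circ> \<theta>\<^sub>\<mu> = \<chi>\<^sub>l\<^sub>\<mu>\<close>, the function \<open>\<chi>\<^sub>l (Fr\<^sub>\<mu> f)\<close> is the right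
  translate \<open>p \<mapsto> h (p a)\<close> of \<open>h = \<chi>\<^sub>l\<^sub>\<mu> f\<close> (\<open>chi_W_Fr_a\<close>). A right translation changes a vector field
  coming from the right action by conjugation with \<open>a\<close>: the diagonal element \<open>a\<close> commutes with
  \<open>exp (t Y)\<close>, while moving it past \<open>exp (t X)\<close> turns \<open>t\<close> into \<open>\<mu> t\<close>. Hence \<open>Y\<close> commutes with the
  translation and \<open>X\<close> acquires the factor \<open>\<mu>\<close> (\<open>Y_field_translate\<close>, \<open>X_field_translate\<close>), so that
  \<open>l X + \<i> Y\<close> applied to the translate of \<open>h\<close> is the translate of \<open>(l \<mu>) X h + \<i> Y h\<close>. This vanishes,
  being the condition on \<open>f\<close> for the parameter \<open>l \<mu>\<close>. The rescaling of \<open>l\<close> by \<open>\<theta>\<^sub>\<mu>\<close> is exactly what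
  compensates the rescaling of \<open>X\<close>.

  Smoothness is preserved because, in the coordinates \<open>(x, y)\<close> on an orbit, the translation by \<open>a\<close>
  is the linear map \<open>(x, y) \<mapsto> (x, y / \<mu>)\<close> (\<open>smooth_on_leaf_translate\<close>).
\<close>

text \<open>
  The derivative of \<open>F \<circ> T\<close> in the direction \<open>v\<close> is the derivative of \<open>F\<close> in the direction \<open>T v\<close>,
  composed with \<open>T\<close>, so the claim passes from each order of differentiability to the next. That
  identity of derivatives holds on \<open>U\<close> only; therefore the function \<open>G\<close> in the induction is only
  required to agree with \<open>F \<circ> T\<close> on the open set \<open>U\<close>.
\<close>

lemma Ck_on_compose_linear:
  assumes "open U" and T: "bounded_linear T" and TU: "T ` U \<subseteq> S"
    and "Ck_on k S F" and "\<And>x. x \<in> U \<Longrightarrow> G x = F (T x)"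
  shows "Ck_on k U G"
  using assms(4,5)
proof (induction k arbitrary: F G)
  case 0
  then have "continuous_on U (\<lambda>x. F (T x))"
    using continuous_on_compose2[of S F U T] TU linear_continuous_on[OF T] by simp
  then show ?case
    using 0 by (simp cong: continuous_on_cong)
next
  case (Suc k)
  have der: "(G has_derivative (\<lambda>v. frechet_derivative F (at (T x)) (T v))) (at x)" if "x \<in> U" for x
  proof -
    have "F differentiable (at (T x))"
      using Suc.prems(1) TU that by auto
    then have "(F has_derivative frechet_derivative F (at (T x))) (at (T x))"
      by (simp add: frechet_derivative_works)
    then have "((\<lambda>x. F (T x)) has_derivative (\<lambda>v. frechet_derivative F (at (T x)) (T v))) (at x)"
      by (intro has_derivative_compose[OF bounded_linear_imp_has_derivative[OF T]])
    then show ?thesis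
      by (rule has_derivative_transform_within_open[OF _ \<open>open U\<close> that])
        (simp add: Suc.prems(2))
  qed
  have "Ck_on k U (\<lambda>x. frechet_derivative G (at x) v)" for v
  proof (rule Suc.IH)
    show "Ck_on k S (\<lambda>y. frechet_derivative F (at y) (T v))"
      using Suc.prems(1) by simp
    show "frechet_derivative G (at x) v = frechet_derivative F (at (T x)) (T v)" if "x \<in> U" for x
      using frechet_derivative_at[OF der[OF that]] by metis
  qed
  moreover have "\<forall>x\<in>U. G differentiable (at x)"
    using der differentiableI by blast
  ultimately show ?case by simp
qed

lemma vector_derivative_rescale_at_0:
  assumes "g differentiable (at 0)"
  shows "vector_derivative (\<lambda>t::real. g (c * t)) (at 0) = c *\<^sub>R vector_derivative g (at 0)"
proof -
  have "((\<lambda>t. c * t) has_vector_derivative c) (at 0)"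
    by (auto intro!: derivative_eq_intros)
  moreover have "(g has_vector_derivative vector_derivative g (at 0)) (at (c * 0))"
    using assms by (simp add: vector_derivative_works)
  ultimately show ?thesis
    using vector_diff_chain_at[of "\<lambda>t. c * t" c 0 g] by (intro vector_derivative_at) (simp add: o_def)
qed

lemma affine_mat_in_P_plus: "0 < u \<Longrightarrow> affine_mat u v \<in> P_plus"
  by (auto simp: P_plus_def)

lemma P_plus_mult: "g \<in> P_plus \<Longrightarrow> h \<in> P_plus \<Longrightarrow> g ** h \<in> P_plus"
  unfolding P_plus_def by clarify (metis affine_mat_mult mult_pos_pos)

lemma right_action_affine:
  assumes "right_action Z act" and "p \<in> Z" and "0 < u" and "0 < u'"
  shows "act (act p (affine_mat u v)) (affine_mat u' v') = act p (affine_mat (u * u') (u * v' + v))"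
  using assms by (simp add: right_action_def affine_mat_in_P_plus affine_mat_mult)

lemma leaf_subset:
  assumes "right_action Z act" and "z \<in> Z"
  shows "leaf act z \<subseteq> Z"
  using assms by (auto simp: leaf_def right_action_def)

lemma leaf_closed:
  assumes "right_action Z act" and "z \<in> Z" and "p \<in> leaf act z" and "g \<in> P_plus"
  shows "act p g \<in> leaf act z"
  using assms P_plus_mult by (fastforce simp: leaf_def right_action_def)

lemma chi_W_Fr_a:
  "chi_W l (Fr_a act \<mu> f p) = chi_W (l * \<mu>) (f (act p (affine_mat (inverse \<mu>) 0)))"
  by (simp add: Fr_a_def R_act_def chi_W_theta_W)

lemma Y_field_translate:
  assumes "right_action Z act" and "p \<in> Z" and "0 < c"
  shows "Y_field act (\<lambda>q. h (act q (affine_mat c 0))) p = Y_field act h (act p (affine_mat c 0))"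
  using assms
  by (simp add: Y_field_def lie_field_def matrix_exp_Y right_action_affine mult.commute)

text \<open>
  Differentiability along the integral curve of \<open>X\<close> is what allows the rescaling of the time parameter,
  because \<open>vector_derivative\<close> is an arbitrary value where no derivative exists.
\<close>

lemma X_field_translate:
  assumes "right_action Z act" and "p \<in> Z" and "0 < c"
    and "(\<lambda>t. h (act (act p (affine_mat c 0)) (affine_mat 1 t))) differentiable (at 0)"
  shows "of_real c * X_field act (\<lambda>q. h (act q (affine_mat c 0))) p
    = X_field act h (act p (affine_mat c 0))"
proof -
  let ?g = "\<lambda>t. h (act (act p (affine_mat c 0)) (affine_mat 1 t))"
  (* affine_mat 1 t ** affine_mat c 0 = affine_mat c 0 ** affine_mat 1 (t / c) *)
  have "h (act (act p (affine_mat 1 t)) (affine_mat c 0)) = ?g (inverse c * t)" for t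
    using assms(1-3) by (simp add: right_action_affine flip: mult.assoc)
  then have "X_field act (\<lambda>q. h (act q (affine_mat c 0))) p
      = vector_derivative (\<lambda>t. ?g (inverse c * t)) (at 0)"
    by (simp only: X_field_def lie_field_def matrix_exp_X)
  also have "\<dots> = inverse c *\<^sub>R vector_derivative ?g (at 0)"
    by (rule vector_derivative_rescale_at_0[OF assms(4)])
  also have "vector_derivative ?g (at 0) = X_field act h (act p (affine_mat c 0))"
    by (simp only: X_field_def lie_field_def matrix_exp_X)
  finally show ?thesis
    using \<open>0 < c\<close> by (simp add: scaleR_conv_of_real)
qed

lemma smooth_on_leaf_differentiable_X:
  assumes "smooth_on_leaf act L h" and "p \<in> L"
  shows "(\<lambda>t. h (act p (affine_mat 1 t))) differentiable (at 0)"
proof -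
  let ?F = "\<lambda>(x, y). h (act p (affine_mat y x))"
  have "Ck_on (Suc 0) {(x, y). 0 < y} ?F"
    using assms unfolding smooth_on_leaf_def Cinf_on_def by blast
  then have "?F differentiable (at (0, 1))"
    by auto
  moreover have "(\<lambda>t. (t, 1)) differentiable (at (0::real))"
    by (intro differentiable_Pair) auto
  ultimately show ?thesis
    using differentiable_chain_at[of "\<lambda>t. (t, 1)" 0 ?F] by (simp add: o_def)
qed

lemma smooth_on_leaf_translate:
  assumes "right_action Z act" and "L \<subseteq> Z" and "0 < c" and "smooth_on_leaf act L h"
  shows "smooth_on_leaf act L (\<lambda>q. h (act q (affine_mat c 0)))"
  unfolding smooth_on_leaf_def Cinf_on_def
proof (intro ballI allI)
  fix p k
  assume "p \<in> L"
  let ?U = "{(x, y). 0 < y} :: (real \<times> real) set"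
  let ?T = "\<lambda>w :: real \<times> real. (fst w, c * snd w)"
  show "Ck_on k ?U (\<lambda>(x, y). h (act (act p (affine_mat y x)) (affine_mat c 0)))"
  proof (rule Ck_on_compose_linear[where T = ?T])
    show "open ?U"
      by (simp add: case_prod_unfold open_Collect_less continuous_on_snd)
    show "bounded_linear ?T"
      by (intro bounded_linear_Pair bounded_linear_fst
          bounded_linear_compose[OF bounded_linear_mult_right bounded_linear_snd])
    show "?T ` ?U \<subseteq> ?U"
      using \<open>0 < c\<close> by auto
    show "Ck_on k ?U (\<lambda>(x, y). h (act p (affine_mat y x)))"
      using assms(4) \<open>p \<in> L\<close> unfolding smooth_on_leaf_def Cinf_on_def by blast
  next
    fix w :: "real \<times> real"
    assume "w \<in> ?U"
    then show "(case w of (x, y) \<Rightarrow> h (act (act p (affine_mat y x)) (affine_mat c 0)))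
        = (case ?T w of (x, y) \<Rightarrow> h (act p (affine_mat y x)))"
      using assms(1-3) \<open>p \<in> L\<close> by (auto simp: right_action_affine subset_iff mult.commute)
  qed
qed

theorem proposition7p1:
  fixes Z :: "'a set" and act :: "'a \<Rightarrow> real^2^2 \<Rightarrow> 'a" and z :: 'a
    and L :: "'a set" and \<mu> :: real and f :: "'a \<Rightarrow> W"
  assumes "right_action Z act" and "z \<in> Z" and "L = leaf act z"
    and "0 < \<mu>"
    and "smooth_W act L f"
    and "holomorphy_condition act L f"
  shows "smooth_W act L (Fr_a act \<mu> f) \<and> holomorphy_condition act L (Fr_a act \<mu> f)"
proof
  let ?c = "inverse \<mu>"
  have "0 < ?c"
    using \<open>0 < \<mu>\<close> by simp
  have "L \<subseteq> Z"
    using leaf_subset assms(1-3) by simp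
  have smooth: "smooth_on_leaf act L (\<lambda>q. chi_W (l * \<mu>) (f q))" if "0 < l" for l
    using assms(4,5) that by (simp add: smooth_W_def)
  show "smooth_W act L (Fr_a act \<mu> f)"
    unfolding smooth_W_def chi_W_Fr_a
    using smooth_on_leaf_translate[OF assms(1) \<open>L \<subseteq> Z\<close> \<open>0 < ?c\<close> smooth] by blast
  show "holomorphy_condition act L (Fr_a act \<mu> f)"
    unfolding holomorphy_condition_def chi_W_Fr_a
  proof (intro allI impI ballI)
    fix l :: real and p
    assume "0 < l" and "p \<in> L"
    let ?h = "\<lambda>q. chi_W (l * \<mu>) (f q)"
    let ?H = "\<lambda>q. ?h (act q (affine_mat ?c 0))"
    let ?pa = "act p (affine_mat ?c 0)"
    have "p \<in> Z"
      using \<open>p \<in> L\<close> \<open>L \<subseteq> Z\<close> by blast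
    have "?pa \<in> L"
      using leaf_closed[OF assms(1,2)] \<open>p \<in> L\<close> assms(3) affine_mat_in_P_plus[OF \<open>0 < ?c\<close>] by simp
    have "of_real ?c * X_field act ?H p = X_field act ?h ?pa"
      by (rule X_field_translate[OF assms(1) \<open>p \<in> Z\<close> \<open>0 < ?c\<close>])
        (rule smooth_on_leaf_differentiable_X[OF smooth[OF \<open>0 < l\<close>] \<open>?pa \<in> L\<close>])
    then have X: "X_field act ?H p = of_real \<mu> * X_field act ?h ?pa"
      using \<open>0 < \<mu>\<close> by (simp add: field_simps)
    have Y: "Y_field act ?H p = Y_field act ?h ?pa"
      by (rule Y_field_translate[OF assms(1) \<open>p \<in> Z\<close> \<open>0 < ?c\<close>])
    have "of_real l * X_field act ?H p + \<i> * Y_field act ?H p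
        = of_real (l * \<mu>) * X_field act ?h ?pa + \<i> * Y_field act ?h ?pa"
      by (simp add: X Y)
    also have "\<dots> = 0"
      using assms(6) \<open>?pa \<in> L\<close> mult_pos_pos[OF \<open>0 < l\<close> \<open>0 < \<mu>\<close>]
      unfolding holomorphy_condition_def by blast
    finally show "of_real l * X_field act ?H p + \<i> * Y_field act ?H p = 0" .
  qed
qed

end
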